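(* For any wheel $W_n$ of order $n\ge 5$, $\gamma_{tc}(M(W_n))=\lceil 2n/3\rceil$.
   Context: All graphs are finite, simple and undirected. The wheel $W_n$ of order $n$ is the graph with vertices $v_0,v_1,\dots,v_{n-1}$ whose edges are $v_0v_i$ for $1\le i\le n-1$ together with the edges of the cycle $v_1v_2\cdots v_{n-1}v_1$. For a graph $H$, a set $D\subseteq V(H)$ is a total dominating set if every vertex of $H$ has a neighbor in $D$. A set $D\subseteq V(H)$ is a total outer-connected dominating set of $H$ if $D$ is a total dominating set and the induced subgraph $H[V(H)\setminus D]$ is connected; $\gamma_{tc}(H)$ denotes the minimum cardinality of a total outer-connected dominating set of $H$. The middle graph $M(G)$ of a graph $G$ has vertex set $V(G)\cup E(G)$, where two elements $x,y$ are adjacent iff either $x,y\in E(G)$ are edges of $G$ sharing an endpoint, or one of them is a vertex of $G$ and the other is an edge of $G$ incident to it. *)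

theory Defs
  imports Complex_Main "Graph_Theory.Graph_Theory"
begin

text \<open>
  Finite simple undirected graphs are represented as the finite, loop-free, symmetric digraphs
  of locale \<open>pair_graph\<close>: each undirected edge \<open>uv\<close> appears as the two arcs
  \<open>(u, v)\<close> and \<open>(v, u)\<close>.
\<close>

definition uedges :: "'a pair_pre_digraph \<Rightarrow> 'a set set" where
  "uedges G = {{u, v} | u v. (u, v) \<in> parcs G}"

definition wheel :: "nat \<Rightarrow> nat pair_pre_digraph" where
  "wheel n =
    (let R = {(0, i) | i. 1 \<le> i \<and> i \<le> n - 1}
           \<union> {(i, i + 1) | i. 1 \<le> i \<and> i < n - 1}
           \<union> {(n - 1, 1)}
     in \<lparr> pverts = {0..<n}, parcs = R \<union> R\<inverse> \<rparr>)"

fun middle_adj :: "'a + 'a set \<Rightarrow> 'a + 'a set \<Rightarrow> bool" where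
  "middle_adj (Inl u) (Inl v) = False"
| "middle_adj (Inl v) (Inr e) = (v \<in> e)"
| "middle_adj (Inr e) (Inl v) = (v \<in> e)"
| "middle_adj (Inr e) (Inr f) = (e \<noteq> f \<and> e \<inter> f \<noteq> {})"

definition middle_graph :: "'a pair_pre_digraph \<Rightarrow> ('a + 'a set) pair_pre_digraph" where
  "middle_graph G =
    (let V = Inl ` pverts G \<union> Inr ` uedges G
     in \<lparr> pverts = V, parcs = {(x, y). x \<in> V \<and> y \<in> V \<and> middle_adj x y} \<rparr>)"

definition total_dominating_set :: "'a pair_pre_digraph \<Rightarrow> 'a set \<Rightarrow> bool" where
  "total_dominating_set H D \<longleftrightarrow>
     D \<subseteq> pverts H \<and> (\<forall>v \<in> pverts H. \<exists>u \<in> D. (u, v) \<in> parcs H)"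

text \<open>
  The qualified name avoids the topological \<open>connected\<close>. The graph without vertices is not
  connected in this sense, so the full vertex set is never total outer-connected dominating.
\<close>

definition total_outer_connected_dominating_set :: "'a pair_pre_digraph \<Rightarrow> 'a set \<Rightarrow> bool" where
  "total_outer_connected_dominating_set H D \<longleftrightarrow>
     total_dominating_set H D \<and>
     Digraph_Component.connected (with_proj H \<restriction> (pverts H - D))"

text \<open>
  As an infimum of natural numbers this is a minimum if a total outer-connected dominating set
  exists, and 0 otherwise. A graph with at least one vertex has no such set of cardinality 0.
\<close>

definition gamma_tc :: "'a pair_pre_digraph \<Rightarrow> nat" where
  "gamma_tc H = Inf (card ` {D. total_outer_connected_dominating_set H D})"

lemma pair_graph_wheel:
  assumes "n \<ge> 4"
  shows "pair_graph (wheel n)"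
proof -
  have sub: "parcs (wheel n) \<subseteq> {0..<n} \<times> {0..<n}"
    using assms by (auto simp: wheel_def Let_def)
  have fin: "finite (parcs (wheel n))"
    by (rule finite_subset[OF sub]) simp
  show ?thesis
  proof
    show "symmetric (with_proj (wheel n))"
      by (auto simp: symmetric_def wheel_def Let_def intro!: symI)
  qed (use assms sub fin in \<open>auto simp: wheel_def Let_def\<close>)
qed

lemma middle_adj_sym: "middle_adj x y \<Longrightarrow> middle_adj y x"
  by (cases x; cases y) auto

lemma middle_adj_irrefl: "\<not> middle_adj x x"
  by (cases x) auto

lemma pair_graph_middle_graph:
  assumes "pair_graph G"
  shows "pair_graph (middle_graph G)"
proof -
  interpret pair_graph G by fact
  have "uedges G \<subseteq> (\<lambda>(u, v). {u, v}) ` parcs G"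
    by (auto simp: uedges_def)
  then have "finite (uedges G)"
    by (rule finite_subset) (simp add: pair_finite_arcs)
  then have finV: "finite (pverts (middle_graph G))"
    by (simp add: middle_graph_def Let_def pair_finite_verts)
  have sub: "parcs (middle_graph G) \<subseteq> pverts (middle_graph G) \<times> pverts (middle_graph G)"
    by (auto simp: middle_graph_def Let_def)
  have fin: "finite (parcs (middle_graph G))"
    by (rule finite_subset[OF sub]) (simp add: finV)
  show ?thesis
  proof
    show "symmetric (with_proj (middle_graph G))"
      by (auto simp: symmetric_def middle_graph_def Let_def intro!: symI dest: middle_adj_sym)
    show "fst e \<noteq> snd e" if "e \<in> parcs (middle_graph G)" for e
      using that by (auto simp: middle_graph_def Let_def middle_adj_irrefl)
  qed (use sub fin finV in auto)
qed

end

theory Submission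
  imports Defs
begin

text \<open>
  Lower bound, for the middle graph of any graph with \<open>n\<close> vertices: let \<open>F\<close> be the edges and \<open>W\<close>
  the vertices contained in a total dominating set. The edges in \<open>F\<close> cover all vertices. Giving a
  vertex of \<open>F\<close>-degree \<open>d\<close> the weight \<open>2/d\<close> for each of its edges distributes total weight \<open>2n\<close> over
  \<open>F\<close>. An edge receives at most \<open>3\<close>, except that an edge isolated in \<open>F\<close> receives \<open>4\<close>; the isolated
  edges are disjoint and each contains a member of \<open>W\<close>. Hence \<open>2n \<le> 3(|F| + |W|)\<close>.

  Upper bound: cut the Hamiltonian path \<open>0, 1, \<dots>, n - 1\<close> of the wheel into segments of at least
  three vertices and take the edges of the segments. Deleting them keeps the wheel connected, since
  all spokes but the one to \<open>1\<close> survive, as does the rim edge between \<open>1\<close> and \<open>n - 1\<close>.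
\<close>

section \<open>Lower bound by weighted double counting\<close>

lemma edge_cover_card_bound:
  fixes V :: "'a set"
  assumes finV: "finite V" and finF: "finite F" and finW: "finite W"
    and edge: "\<And>e. e \<in> F \<Longrightarrow> e \<subseteq> V \<and> card e = 2"
    and cover: "\<And>v. v \<in> V \<Longrightarrow> \<exists>e\<in>F. v \<in> e"
    and dom: "\<And>e. e \<in> F \<Longrightarrow> W \<inter> e \<noteq> {} \<or> (\<exists>f\<in>F. f \<noteq> e \<and> f \<inter> e \<noteq> {})"
  shows "2 * card V \<le> 3 * (card F + card W)"
proof -
  define d where "d v = card {e \<in> F. v \<in> e}" for v
  define I where "I = {e \<in> F. \<forall>f\<in>F. f \<noteq> e \<longrightarrow> f \<inter> e = {}}"
  have d_ge_1: "d v \<ge> 1" if "v \<in> V" for v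
  proof -
    have "{e \<in> F. v \<in> e} \<noteq> {}" using cover[OF that] by blast
    then show ?thesis using finF by (simp add: d_def Suc_le_eq card_gt_0_iff)
  qed
  \<comment> \<open>An edge meeting no other edge of \<open>F\<close> can only be dominated through
    \<open>W\<close>; choosing such a member for each is injective because these edges are pairwise
    disjoint.\<close>
  have IW: "\<forall>e\<in>I. \<exists>w. w \<in> W \<inter> e"
    using dom by (fastforce simp: I_def)
  then obtain w where w: "\<And>e. e \<in> I \<Longrightarrow> w e \<in> W \<inter> e"
    by metis
  have "inj_on w I"
  proof (rule inj_onI)
    fix e f assume "e \<in> I" "f \<in> I" "w e = w f"
    then have "w e \<in> e \<inter> f" using w by fastforce
    then show "e = f" using \<open>e \<in> I\<close> \<open>f \<in> I\<close> by (auto simp: I_def)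
  qed
  then have card_I: "card I \<le> card W"
    by (rule card_inj_on_le) (use w finW in auto)
  have weight: "(\<Sum>v\<in>e. 2 / real (d v)) \<le> 3 + (if e \<in> I then 1 else 0)" if e: "e \<in> F" for e
  proof -
    obtain x y where xy: "e = {x, y}" "x \<noteq> y"
      using edge[OF e] by (auto simp: card_2_iff)
    have ge1: "d x \<ge> 1" "d y \<ge> 1" using edge[OF e] xy d_ge_1 by auto
    then have le2: "2 / real (d x) \<le> 2" "2 / real (d y) \<le> 2"
      by (simp_all add: field_simps)
    have sum: "(\<Sum>v\<in>e. 2 / real (d v)) = 2 / real (d x) + 2 / real (d y)"
      using xy by simp
    show ?thesis
    proof (cases "e \<in> I")
      case True
      then show ?thesis using sum le2 by simp
    next
      case False
      then obtain f v where f: "f \<in> F" "f \<noteq> e" "v \<in> f" "v \<in> e"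
        using e by (auto simp: I_def)
      \<comment> \<open>The second edge at \<open>v\<close> halves what \<open>e\<close> receives
        from \<open>v\<close>: at most 1, besides at most 2 from the other end.\<close>
      have "card {e, f} \<le> d v"
        unfolding d_def by (rule card_mono) (use f e finF in auto)
      then have "d v \<ge> 2" using f by simp
      then have "2 / real (d v) \<le> 1" by (simp add: field_simps)
      moreover have "v = x \<or> v = y" using f xy by auto
      ultimately show ?thesis using sum le2 False by auto
    qed
  qed
  have "2 * real (card V) = (\<Sum>v\<in>V. \<Sum>e | e \<in> F \<and> v \<in> e. 2 / real (d v))"
  proof -
    \<comment> \<open>Coverage enters here: with \<open>d v = 0\<close> the sum would be
      empty.\<close>
    have "(\<Sum>e | e \<in> F \<and> v \<in> e. 2 / real (d v)) = 2" if "v \<in> V" for v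
      using d_ge_1[OF that] by (simp flip: d_def)
    then show ?thesis by simp
  qed
  also have "\<dots> = (\<Sum>e\<in>F. \<Sum>v | v \<in> V \<and> v \<in> e. 2 / real (d v))"
    by (rule sum.swap_restrict[OF finV finF])
  also have "\<dots> = (\<Sum>e\<in>F. \<Sum>v\<in>e. 2 / real (d v))"
  proof (rule sum.cong[OF refl])
    fix e assume "e \<in> F"
    then have "{v. v \<in> V \<and> v \<in> e} = e" using edge by auto
    then show "(\<Sum>v | v \<in> V \<and> v \<in> e. 2 / real (d v)) = (\<Sum>v\<in>e. 2 / real (d v))"
      by simp
  qed
  also have "\<dots> \<le> (\<Sum>e\<in>F. 3 + (if e \<in> I then 1 else 0))"
    by (rule sum_mono) (rule weight)
  also have "\<dots> = 3 * real (card F) + real (card I)"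
  proof -
    have "F \<inter> I = I" by (auto simp: I_def)
    then show ?thesis using finF by (simp add: sum.distrib flip: sum.inter_restrict)
  qed
  finally have "real (2 * card V) \<le> real (3 * card F + card I)" by simp
  then have "2 * card V \<le> 3 * card F + card I" by (simp only: of_nat_le_iff)
  also have "\<dots> \<le> 3 * card F + 3 * card W" using card_I by simp
  finally show ?thesis by simp
qed

text \<open>In the middle graph a vertex is adjacent only to edges, so the edges in \<open>D\<close>
  must cover \<open>pverts G\<close>; an edge in \<open>D\<close> is dominated by one of its ends or
  by another edge that it meets.\<close>

lemma total_dominating_middle_graph_card_bound:
  assumes G: "pair_graph G" and D: "total_dominating_set (middle_graph G) D"
  shows "2 * card (pverts G) \<le> 3 * card D"
proof -
  interpret pair_graph G by fact
  interpret M: pair_graph "middle_graph G" by (rule pair_graph_middle_graph[OF G])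
  define W where "W = Inl -` D"
  define F where "F = Inr -` D"
  have D_eq: "D = Inl ` W \<union> Inr ` F"
  proof -
    have "x \<in> Inl ` W \<union> Inr ` F" if "x \<in> D" for x
      using that by (cases x) (auto simp: W_def F_def)
    then show ?thesis by (auto simp: W_def F_def)
  qed
  have D_sub: "D \<subseteq> Inl ` pverts G \<union> Inr ` uedges G"
    using D by (simp add: total_dominating_set_def middle_graph_def Let_def)
  have "finite D"
    using D M.pair_finite_verts by (auto simp: total_dominating_set_def intro: finite_subset)
  then have fin: "finite W" "finite F"
    by (auto simp: W_def F_def intro: finite_vimageI)
  have dominated: "\<exists>u\<in>D. middle_adj u v" if "v \<in> Inl ` pverts G \<union> Inr ` uedges G" for v
    using D that by (auto simp: total_dominating_set_def middle_graph_def Let_def)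
  have F_sub: "F \<subseteq> uedges G" using D_sub by (auto simp: F_def)
  have "2 * card (pverts G) \<le> 3 * (card F + card W)"
  proof (rule edge_cover_card_bound[OF pair_finite_verts fin(2) fin(1)])
    fix e assume "e \<in> F"
    then obtain u v where uv: "e = {u, v}" "(u, v) \<in> parcs G"
      using F_sub by (auto simp: uedges_def)
    then show "e \<subseteq> pverts G \<and> card e = 2"
      using pair_no_loops in_arcsD1 in_arcsD2 by fastforce
  next
    fix v assume "v \<in> pverts G"
    then obtain u where "u \<in> D" "middle_adj u (Inl v)" using dominated by blast
    then show "\<exists>e\<in>F. v \<in> e" by (cases u) (auto simp: F_def)
  next
    fix e assume "e \<in> F"
    then obtain u where "u \<in> D" "middle_adj u (Inr e)" using dominated F_sub by blast
    then show "W \<inter> e \<noteq> {} \<or> (\<exists>f\<in>F. f \<noteq> e \<and> f \<inter> e \<noteq> {})"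
      by (cases u) (auto simp: F_def W_def)
  qed
  moreover have "card D = card W + card F"
    unfolding D_eq using fin by (subst card_Un_disjoint) (auto simp: card_image)
  ultimately show ?thesis by simp
qed

section \<open>Connectivity of the middle graph after deleting edges\<close>

text \<open>A step from \<open>u\<close> to \<open>v\<close> along a surviving edge lifts to the
  path \<open>Inl u\<close>, \<open>Inr {u, v}\<close>, \<open>Inl v\<close>. All original vertices
  survive, so every remaining edge hangs on one of its ends.\<close>

lemma connected_middle_graph_minus_edges:
  assumes G: "pair_graph G" and r: "r \<in> pverts G"
    and reach: "\<And>v. v \<in> pverts G \<Longrightarrow> (r, v) \<in> {(u, v) \<in> parcs G. {u, v} \<notin> F}\<^sup>*"
  shows "Digraph_Component.connected
    (with_proj (middle_graph G) \<restriction> (pverts (middle_graph G) - Inr ` F))"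
proof -
  interpret pair_graph G by fact
  interpret M: pair_graph "middle_graph G" by (rule pair_graph_middle_graph[OF G])
  let ?S = "pverts (middle_graph G) - Inr ` F"
  let ?H = "with_proj (middle_graph G) \<restriction> ?S"
  \<comment> \<open>\<open>connected\<close> unfolds to strong connectivity of the symmetric
    closure, so reachability is studied there.\<close>
  interpret S: pair_wf_digraph "mk_symmetric ?H"
    by (intro wf_digraph.wellformed_mk_symmetric M.wellformed_induce_subgraph)
  have verts: "?S = Inl ` pverts G \<union> Inr ` (uedges G - F)"
    by (auto simp: middle_graph_def Let_def)
  have adj: "(x, y) \<in> parcs (mk_symmetric ?H)" if "x \<in> ?S" "y \<in> ?S" "middle_adj x y" for x y
    using that by (auto simp: parcs_mk_symmetric middle_graph_def Let_def)
  have reach_vertex: "Inl r \<rightarrow>\<^sup>*\<^bsub>mk_symmetric ?H\<^esub> Inl v" if "v \<in> pverts G" for v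
    using reach[OF that]
  proof induction
    case base
    have "Inl r \<in> pverts (mk_symmetric ?H)" using r verts by simp
    then show ?case by (rule S.reachable_refl)
  next
    case (step u v)
    then have uv: "(u, v) \<in> parcs G" "{u, v} \<notin> F" by auto
    then have "Inl u \<in> ?S" "Inl v \<in> ?S" "Inr {u, v} \<in> ?S"
      unfolding verts by (auto simp: uedges_def in_arcsD1 in_arcsD2)
    then have "(Inl u, Inr {u, v}) \<in> parcs (mk_symmetric ?H)" "(Inr {u, v}, Inl v) \<in> parcs (mk_symmetric ?H)"
      by (intro adj; simp)+
    with step.IH show ?case by (meson S.reachable_adj_trans)
  qed
  have reach_all: "Inl r \<rightarrow>\<^sup>*\<^bsub>mk_symmetric ?H\<^esub> x" if "x \<in> ?S" for x
  proof (cases x)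
    case (Inl v)
    then show ?thesis using that reach_vertex verts by auto
  next
    case (Inr e)
    then have "e \<in> uedges G" "e \<notin> F" using that unfolding verts by auto
    then obtain u v where uv: "e = {u, v}" "(u, v) \<in> parcs G" "e \<notin> F"
      by (auto simp: uedges_def)
    then have "Inl u \<in> ?S" unfolding verts by (auto simp: in_arcsD1)
    then have "(Inl u, x) \<in> parcs (mk_symmetric ?H)"
      by (rule adj) (use that Inr uv in auto)
    then show ?thesis
      using reach_vertex[of u] uv by (meson S.reachable_adj_trans in_arcsD1)
  qed
  have "x \<rightarrow>\<^sup>*\<^bsub>mk_symmetric ?H\<^esub> y" if "x \<in> ?S" "y \<in> ?S" for x y
    using symmetric_reachable[OF symmetric_mk_symmetric reach_all[OF that(1)]] reach_all[OF that(2)]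
    by (rule S.reachable_trans)
  moreover have "?S \<noteq> {}" using r verts by auto
  ultimately show ?thesis
    by (simp add: connected_def strongly_connected_def)
qed

section \<open>Upper bound for the wheel\<close>

lemma parcs_middle_graph:
  "parcs (middle_graph G) =
    {(x, y). x \<in> pverts (middle_graph G) \<and> y \<in> pverts (middle_graph G) \<and> middle_adj x y}"
  by (simp add: middle_graph_def Let_def)

lemma pverts_wheel: "pverts (wheel n) = {0..<n}"
  by (simp add: wheel_def Let_def)

lemma wheel_spoke: "1 \<le> i \<Longrightarrow> i < n \<Longrightarrow> (0, i) \<in> parcs (wheel n)"
  by (auto simp: wheel_def Let_def)

lemma wheel_path: "i + 1 < n \<Longrightarrow> (i, i + 1) \<in> parcs (wheel n)"
  by (auto simp: wheel_def Let_def)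

lemma wheel_closing: "(n - 1, 1) \<in> parcs (wheel n)"
  by (auto simp: wheel_def Let_def)

lemma uedges_wheel_subset: "e \<in> uedges (wheel n) \<Longrightarrow> n \<ge> 2 \<Longrightarrow> e \<subseteq> {0..<n} \<and> e \<noteq> {}"
  by (auto simp: uedges_def wheel_def Let_def)

text \<open>
  The indices \<open>i\<close> of the edges \<open>{i, i + 1}\<close> of the Hamiltonian path \<open>0, 1, \<dots>, n - 1\<close> that are kept
  after cutting it into segments of three vertices, the last segment absorbing the remainder.
\<close>

definition segment_idx :: "nat \<Rightarrow> nat set" where
  "segment_idx n = {i. i + 1 < n \<and> (i mod 3 = 2 \<longrightarrow> n < i + 4)}"

definition segment_edges :: "nat \<Rightarrow> nat set set" where
  "segment_edges n = (\<lambda>i. {i, i + 1}) ` segment_idx n"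

text \<open>The path has \<open>n - 1\<close> edges, and its \<open>n div 3\<close> segments are
  separated by \<open>n div 3 - 1\<close> cuts.\<close>

lemma card_segment_edges:
  assumes "n \<ge> 3"
  shows "card (segment_edges n) = n - n div 3"
proof -
  \<comment> \<open>The cut indices 2, 5, 8, ..., as long as at least three vertices remain after
    the cut.\<close>
  let ?C = "(\<lambda>j. 3 * j + 2) ` {..<n div 3 - 1}"
  have "inj (\<lambda>i::nat. {i, i + 1})"
    by (rule injI) (auto simp: doubleton_eq_iff)
  then have "card (segment_edges n) = card (segment_idx n)"
    unfolding segment_edges_def by (intro card_image) (auto intro: inj_on_subset)
  moreover have "segment_idx n = {..<n - 1} - ?C"
  proof -
    have "i \<in> ?C \<longleftrightarrow> i mod 3 = 2 \<and> i + 4 \<le> n" for i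
    proof
      assume "i mod 3 = 2 \<and> i + 4 \<le> n"
      moreover have "i = 3 * (i div 3) + i mod 3" "n = 3 * (n div 3) + n mod 3" "n mod 3 < 3"
        by simp_all
      ultimately have "i = 3 * (i div 3) + 2" "i div 3 < n div 3 - 1" by linarith+
      then show "i \<in> ?C" by blast
    next
      assume "i \<in> ?C"
      then obtain j where "i = 3 * j + 2" "j < n div 3 - 1" by auto
      moreover have "3 * (n div 3) \<le> n" by simp
      ultimately have "i + 4 \<le> n" by linarith
      then show "i mod 3 = 2 \<and> i + 4 \<le> n" using \<open>i = 3 * j + 2\<close> by presburger
    qed
    then show ?thesis by (auto simp: segment_idx_def)
  qed
  moreover have "?C \<subseteq> {..<n - 1}" by auto
  moreover have "card ?C = n div 3 - 1" by (subst card_image) (auto simp: inj_on_def)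
  ultimately have "card (segment_edges n) = (n - 1) - (n div 3 - 1)"
    by (simp add: card_Diff_subset)
  then show ?thesis using assms by linarith
qed

text \<open>No segment is a single vertex, so a path edge on one side of \<open>v\<close> is
  kept.\<close>

lemma segment_idx_near:
  assumes "n \<ge> 3" "v < n"
  shows "v \<in> segment_idx n \<or> (v \<ge> 1 \<and> v - 1 \<in> segment_idx n)"
  using assms by (cases v) (auto simp: segment_idx_def mod_Suc split: if_splits)

text \<open>Three vertices per segment mean at least two edges, so no kept edge is isolated.\<close>

lemma segment_idx_neighbour:
  assumes "n \<ge> 3" "i \<in> segment_idx n"
  shows "i + 1 \<in> segment_idx n \<or> (i \<ge> 1 \<and> i - 1 \<in> segment_idx n)"
  using assms by (cases i) (auto simp: segment_idx_def mod_Suc split: if_splits)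

lemma segment_edges_cover:
  assumes "n \<ge> 3" "v < n"
  shows "\<exists>f\<in>segment_edges n. v \<in> f"
  using segment_idx_near[OF assms]
proof
  assume "v \<in> segment_idx n"
  then show ?thesis by (auto simp: segment_edges_def)
next
  assume "v \<ge> 1 \<and> v - 1 \<in> segment_idx n"
  then show ?thesis by (intro bexI[of _ "{v - 1, v - 1 + 1}"]) (auto simp: segment_edges_def)
qed

lemma segment_edges_dominate:
  assumes "n \<ge> 3" "e \<subseteq> {0..<n}" "e \<noteq> {}"
  shows "\<exists>f\<in>segment_edges n. f \<noteq> e \<and> f \<inter> e \<noteq> {}"
proof (cases "e \<in> segment_edges n")
  case True
  then obtain i where i: "i \<in> segment_idx n" "e = {i, i + 1}"
    by (auto simp: segment_edges_def)
  from segment_idx_neighbour[OF assms(1) i(1)] obtain j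
    where "j \<in> segment_idx n" "j = i + 1 \<or> i = j + 1" by force
  then show ?thesis
    using i by (intro bexI[of _ "{j, j + 1}"]) (auto simp: segment_edges_def doubleton_eq_iff)
next
  case False
  obtain v where "v \<in> e" using assms by auto
  then show ?thesis using False segment_edges_cover[of n v] assms by fastforce
qed

lemma segment_edges_total_dominating:
  assumes "n \<ge> 3"
  shows "total_dominating_set (middle_graph (wheel n)) (Inr ` segment_edges n)"
proof -
  have sub: "segment_edges n \<subseteq> uedges (wheel n)"
  proof
    fix e assume "e \<in> segment_edges n"
    then obtain i where "e = {i, i + 1}" "i + 1 < n"
      by (auto simp: segment_edges_def segment_idx_def)
    then show "e \<in> uedges (wheel n)"
      using wheel_path[of i n] by (auto simp: uedges_def)
  qed
  have "\<exists>u\<in>Inr ` segment_edges n. middle_adj u x" if "x \<in> pverts (middle_graph (wheel n))" for x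
  proof (cases x)
    case (Inl v)
    then have "v < n" using that by (auto simp: middle_graph_def Let_def pverts_wheel)
    then show ?thesis using segment_edges_cover[OF assms] Inl by force
  next
    case (Inr e)
    then have "e \<in> uedges (wheel n)" using that by (auto simp: middle_graph_def Let_def)
    then have "e \<subseteq> {0..<n}" "e \<noteq> {}" using uedges_wheel_subset assms by auto
    then show ?thesis using segment_edges_dominate[OF assms] Inr by force
  qed
  moreover have "Inr ` segment_edges n \<subseteq> pverts (middle_graph (wheel n))"
    using sub by (auto simp: middle_graph_def Let_def)
  ultimately show ?thesis
    unfolding total_dominating_set_def parcs_middle_graph by blast
qed

lemma segment_edges_outer_connected:
  assumes "n \<ge> 4"
  shows "Digraph_Component.connected
    (with_proj (middle_graph (wheel n)) \<restriction>
      (pverts (middle_graph (wheel n)) - Inr ` segment_edges n))"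
proof (rule connected_middle_graph_minus_edges)
  let ?R = "{(u, v) \<in> parcs (wheel n). {u, v} \<notin> segment_edges n}"
  show "pair_graph (wheel n)" using assms by (rule pair_graph_wheel)
  show "0 \<in> pverts (wheel n)" using assms by (simp add: pverts_wheel)
  fix v assume "v \<in> pverts (wheel n)"
  then have v: "v < n" by (simp add: pverts_wheel)
  have spoke: "(0, i) \<in> ?R" if "2 \<le> i" "i < n" for i
    using that wheel_spoke[of i n] by (auto simp: segment_edges_def doubleton_eq_iff)
  \<comment> \<open>For \<open>n \<ge> 4\<close> the ends \<open>n - 1\<close> and 1 are not
    consecutive on the path. This edge replaces the spoke to 1, which is the deleted path edge
    \<open>{0, 1}\<close>.\<close>
  have closing: "(n - 1, 1) \<in> ?R"
    using assms wheel_closing[of n] by (auto simp: segment_edges_def doubleton_eq_iff)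
  show "(0, v) \<in> ?R\<^sup>*"
  proof -
    consider "v = 0" | "v = 1" | "v \<ge> 2" by linarith
    then show ?thesis
    proof cases
      case 1
      then show ?thesis by simp
    next
      case 2
      have "(0, n - 1) \<in> ?R" by (rule spoke) (use assms in auto)
      then show ?thesis unfolding 2 using closing by (meson r_into_rtrancl rtrancl.rtrancl_into_rtrancl)
    next
      case 3
      then show ?thesis using spoke v by blast
    qed
  qed
qed

theorem theorem2p5:
  fixes n :: nat
  assumes "n \<ge> 5"
  shows "int (gamma_tc (middle_graph (wheel n))) = \<lceil>2 * real n / 3\<rceil>"
proof -
  let ?M = "middle_graph (wheel n)"
  have "gamma_tc ?M = n - n div 3"
    unfolding gamma_tc_def
  proof (rule cInf_eq_minimum)
    have "total_outer_connected_dominating_set ?M (Inr ` segment_edges n)"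
      using assms segment_edges_total_dominating segment_edges_outer_connected
      by (simp add: total_outer_connected_dominating_set_def)
    moreover have "card (Inr ` segment_edges n :: (nat + nat set) set) = n - n div 3"
      using card_segment_edges[of n] assms by (simp add: card_image)
    ultimately show "n - n div 3 \<in> card ` {D. total_outer_connected_dominating_set ?M D}"
      by (metis (mono_tags) image_eqI mem_Collect_eq)
  next
    fix m assume "m \<in> card ` {D. total_outer_connected_dominating_set ?M D}"
    then obtain D where D: "total_dominating_set ?M D" "m = card D"
      by (auto simp: total_outer_connected_dominating_set_def)
    have "2 * card (pverts (wheel n)) \<le> 3 * m"
      unfolding D(2)
      by (rule total_dominating_middle_graph_card_bound[OF pair_graph_wheel D(1)]) (use assms in simp)
    then show "n - n div 3 \<le> m" unfolding pverts_wheel by simp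
  qed
  moreover have "\<lceil>2 * real n / 3\<rceil> = int (n - n div 3)"
  proof (rule ceiling_unique)
    \<comment> \<open>\<open>3 * (n - n div 3)\<close> equals \<open>2 * n + n mod 3\<close>, hence
      lies between \<open>2 * n\<close> and \<open>2 * n + 2\<close>.\<close>
    have "n = 3 * (n div 3) + n mod 3" "n mod 3 < 3" by simp_all
    then have "3 * (n - n div 3) < 2 * n + 3" "2 * n \<le> 3 * (n - n div 3)" by linarith+
    then have "real (3 * (n - n div 3)) < real (2 * n + 3)" "real (2 * n) \<le> real (3 * (n - n div 3))"
      by (simp_all only: of_nat_less_iff of_nat_le_iff)
    then show "real_of_int (int (n - n div 3)) - 1 < 2 * real n / 3"
      "2 * real n / 3 \<le> real_of_int (int (n - n div 3))"
      by (simp_all add: field_simps)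
  qed
  ultimately show ?thesis by simp
qed

end
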